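(* Let $f=\frac1N\sum_{i=1}^N F_i$ satisfy the spectral upper bound condition with constant $L$ and the global strong convexity condition $\nabla^2 f(w)\succeq \mu I$ for all $w\in\mathbb{R}^d$, for some $\mu>0$, and let $w^*$ be the unique minimizer of $f$. For any $w_0\in\mathbb{R}^d$, let $\{w_k\}$ be generated by $w_{k+1}=w_k-\alpha_k\widetilde H_k^{-1}g_k$. Suppose that for every $k\ge 0$ the gradient approximation satisfies the deterministic norm condition $$\|g_k-\nabla f(w_k)\|_{A_k}^2\le \theta_k^2\|\nabla f(w_k)\|_{A_k}^2+\iota_k$$ with $A_k=\widetilde H_k^{-1}$, $\theta_k=\tilde\theta_g\in[0,1)$, and $\iota_{k+1}=\iota_k a_g$ for some $\iota_0>0$ and $a_g\in[0,1)$. If the step size is $\alpha_k=\alpha$ with $0<\alpha\le \tilde\mu/L$, then for all $k\ge 0$ $$f(w_k)-f(w^* )\le \tilde C_1\tilde\rho_1^{\,k},$$ where $$\tilde C_1:=\max\Big\{f(w_0)-f(w^* ),\ \frac{\tilde L\iota_0}{\mu(1-\tilde\theta_g^2)}\Big\},\qquad \tilde\rho_1:=\max\Big\{1-\frac{\alpha\mu(1-\tilde\theta_g^2)}{2\tilde L},\ a_g\Big\}.$$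
   Context: Setting: $f:\mathbb{R}^d\to\mathbb{R}$, $f=\frac1N\sum_{i=1}^N F_i$ with each $F_i$ twice continuously differentiable; for a nonempty sample set $S\subseteq\{1,\dots,N\}$, $F_S=\frac{1}{|S|}\sum_{i\in S}F_i$. The vector $g_k\in\mathbb{R}^d$ is an approximation of $\nabla f(w_k)$. Hessian approximation: sample sets $S_0,S_1,\dots$ are given; for each $k$ there are weights $\gamma_0,\dots,\gamma_k\in[0,1]$ (possibly depending on $k$) with $\sum_{i=0}^k\gamma_i=1$, and $\widehat H_k=\sum_{i=0}^k\gamma_i\nabla^2F_{S_i}(w_i)$. For a symmetric matrix $A=U\Lambda U^T$, $|A|=U|\Lambda|U^T$. For fixed $\tilde\mu>0$, $\widetilde H_k=|\widehat H_k|$ if $\lambda_{\min}(|\widehat H_k|)\ge\tilde\mu$, and $\widetilde H_k=|\widehat H_k|+(\tilde\mu-\lambda_{\min}(|\widehat H_k|))I$ otherwise; thus $\widetilde H_k\succeq\tilde\mu I$. Spectral upper bound condition: for every sample size $|S|$ there is $0<L_{|S|}<\infty$ with $\nabla^2F_S(w)\preceq L_{|S|}I$ for all $w\in\mathbb{R}^d$, and $L_{|S|}\le L<\infty$ for all $|S|$; consequently $\nabla^2 f(w)\preceq LI$ for all $w$. $\tilde L$ denotes a constant with $\widetilde H_k\preceq\tilde LI$ for all $k$ (with $\tilde L\le L+\tilde\mu$). Norms: $\|\cdot\|$ is the Euclidean norm and $\|v\|_A=\sqrt{v^TAv}$ for symmetric positive definite $A$. *)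

theory Defs
  imports "HOL-Analysis.Analysis"
begin

definition gradient :: "(real ^ 'n \<Rightarrow> real) \<Rightarrow> real ^ 'n \<Rightarrow> real ^ 'n" where
  "gradient f x = (THE D. GDERIV f x :> D)"

definition hessian :: "(real ^ 'n \<Rightarrow> real) \<Rightarrow> real ^ 'n \<Rightarrow> real ^ 'n ^ 'n" where
  "hessian f x = jacobian (gradient f) (at x)"

definition twice_continuously_differentiable :: "(real ^ 'n \<Rightarrow> real) \<Rightarrow> bool" where
  "twice_continuously_differentiable f \<longleftrightarrow>
     (\<forall>x. f differentiable (at x)) \<and>
     (\<forall>x. gradient f differentiable (at x)) \<and>
     continuous_on UNIV (hessian f)"

text \<open>The Loewner order, stated through quadratic forms; it is only meaningful (and only used
  below) for symmetric matrices. The matrix \<open>c I\<close> is written \<open>mat c\<close>.\<close>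

definition loewner_le :: "real ^ 'n ^ 'n \<Rightarrow> real ^ 'n ^ 'n \<Rightarrow> bool" (infix \<open>\<preceq>\<close> 50) where
  "A \<preceq> B \<longleftrightarrow> (\<forall>v. v \<bullet> (A *v v) \<le> v \<bullet> (B *v v))"

definition diag_matrix :: "real ^ 'n \<Rightarrow> real ^ 'n ^ 'n" where
  "diag_matrix l = (\<chi> i j. if i = j then l $ i else 0)"

text \<open>\<open>|A| = U |\<Lambda>| U\<^sup>T\<close> for any orthogonal diagonalization \<open>A = U \<Lambda> U\<^sup>T\<close> of a symmetric matrix;
  the result does not depend on the diagonalization. The value is unspecified when \<open>A\<close> is not
  symmetric.\<close>

definition matrix_abs :: "real ^ 'n ^ 'n \<Rightarrow> real ^ 'n ^ 'n" where
  "matrix_abs A = (THE B. \<exists>U l. orthogonal_matrix U \<and>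
      A = U ** diag_matrix l ** transpose U \<and>
      B = U ** diag_matrix (\<chi> i. \<bar>l $ i\<bar>) ** transpose U)"

definition lambda_min :: "real ^ 'n ^ 'n \<Rightarrow> real" where
  "lambda_min A = Min {l. \<exists>v. v \<noteq> 0 \<and> A *v v = l *\<^sub>R v}"

definition mat_norm :: "real ^ 'n ^ 'n \<Rightarrow> real ^ 'n \<Rightarrow> real" where
  "mat_norm A v = sqrt (v \<bullet> (A *v v))"

definition sample_avg :: "(nat \<Rightarrow> real ^ 'n \<Rightarrow> real) \<Rightarrow> nat set \<Rightarrow> real ^ 'n \<Rightarrow> real" where
  "sample_avg F S w = (1 / real (card S)) * (\<Sum>i\<in>S. F i w)"

text \<open>\<open>Ls n\<close> is the constant attached to the sample size \<open>n\<close>.\<close>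

definition spectral_upper_bound :: "nat \<Rightarrow> (nat \<Rightarrow> real ^ 'n \<Rightarrow> real) \<Rightarrow> real \<Rightarrow> bool" where
  "spectral_upper_bound N F L \<longleftrightarrow>
     (\<exists>Ls :: nat \<Rightarrow> real. \<forall>n\<in>{1..N}. 0 < Ls n \<and> Ls n \<le> L \<and>
        (\<forall>S. S \<subseteq> {1..N} \<and> card S = n \<longrightarrow> (\<forall>w. hessian (sample_avg F S) w \<preceq> mat (Ls n))))"

text \<open>In \<open>hess_avg\<close>, \<open>\<gamma> k i\<close> is the weight of the \<open>i\<close>-th sampled Hessian in the \<open>k\<close>-th average.\<close>

definition hess_avg ::
  "(nat \<Rightarrow> real ^ 'n \<Rightarrow> real) \<Rightarrow> (nat \<Rightarrow> nat set) \<Rightarrow> (nat \<Rightarrow> nat \<Rightarrow> real) \<Rightarrow> (nat \<Rightarrow> real ^ 'n)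
     \<Rightarrow> nat \<Rightarrow> real ^ 'n ^ 'n" where
  "hess_avg F S \<gamma> w k = (\<Sum>i\<le>k. \<gamma> k i *\<^sub>R hessian (sample_avg F (S i)) (w i))"

definition hess_mod :: "real \<Rightarrow> real ^ 'n ^ 'n \<Rightarrow> real ^ 'n ^ 'n" where
  "hess_mod \<mu>t H =
     (if lambda_min (matrix_abs H) \<ge> \<mu>t then matrix_abs H
      else matrix_abs H + mat (\<mu>t - lambda_min (matrix_abs H)))"

end

theory Submission
  imports Defs
begin

text \<open>Write \<open>P\<^sub>k\<close> for the inverse of \<open>H\<^sub>k\<close>, the modified Hessian, and \<open>\<nabla>\<^sub>k\<close> for \<open>\<nabla>f(w\<^sub>k)\<close>. Since \<open>H\<^sub>k\<close> is
  symmetric with \<open>\<mu>t I \<preceq> H\<^sub>k \<preceq> Lt I\<close>, we have \<open>\<mu>t \<parallel>P\<^sub>k g\<^sub>k\<parallel>\<^sup>2 \<le> g\<^sub>k \<bullet> P\<^sub>k g\<^sub>k\<close> and \<open>\<parallel>\<nabla>\<^sub>k\<parallel>\<^sup>2 \<le> Lt (\<nabla>\<^sub>k \<bullet> P\<^sub>k \<nabla>\<^sub>k)\<close>.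
  The first bound and \<open>\<alpha> L \<le> \<mu>t\<close> let the quadratic term of the descent inequality complete the square,
  giving \<open>f(w\<^sub>k\<^sub>+\<^sub>1) \<le> f(w\<^sub>k) + (\<alpha>/2) (\<parallel>g\<^sub>k - \<nabla>\<^sub>k\<parallel>\<^sup>2 - \<parallel>\<nabla>\<^sub>k\<parallel>\<^sup>2)\<close> in the norm of \<open>P\<^sub>k\<close>. The norm condition, the second
  bound and the Polyak-Lojasiewicz inequality turn this into a contraction by \<open>1 - q\<close>, up to a
  geometrically decaying error, with \<open>q = \<alpha> \<mu> (1 - \<theta>\<^sup>2) / Lt\<close>.
  That \<open>|A|\<close> and its least eigenvalue behave as intended rests on the spectral theorem, and the
  symmetry of Hessians on second differences.\<close>

section \<open>Gradients and Hessians\<close>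

lemma gradient_eqI:
  assumes "GDERIV f x :> D"
  shows "gradient f x = D"
  unfolding gradient_def
proof (rule the_equality)
  show "GDERIV f x :> D" by (rule assms)
  fix D' assume "GDERIV f x :> D'"
  with assms have "(\<lambda>h. h \<bullet> D') = (\<lambda>h. h \<bullet> D)"
    unfolding gderiv_def by (metis has_derivative_unique)
  then show "D' = D"
    by (metis vector_eq_ldot)
qed

text \<open>A linear functional is represented by the vector of its values on the standard basis;
  uniqueness then identifies that vector with the description defining
  \<open>gradient\<close>.\<close>

lemma GDERIV_gradient:
  fixes f :: "real ^ 'n \<Rightarrow> real"
  assumes "f differentiable (at x)"
  shows "GDERIV f x :> gradient f x"
proof -
  obtain f' where f': "(f has_derivative f') (at x)"
    using assms by (auto simp: differentiable_def)
  then interpret linear f' by (rule has_derivative_linear)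
  have "f' h = h \<bullet> (\<chi> i. f' (axis i 1))" for h
  proof -
    have "f' h = f' (\<Sum>i\<in>UNIV. h $ i *\<^sub>R axis i 1)"
      using basis_expansion[of h] by (simp add: scalar_mult_eq_scaleR)
    then show ?thesis
      by (simp add: sum scaleR inner_vec_def)
  qed
  then have "GDERIV f x :> (\<chi> i. f' (axis i 1))"
    using f' unfolding gderiv_def by (metis (no_types, lifting) ext)
  then show ?thesis
    using gradient_eqI by metis
qed

text \<open>Both \<open>gradient\<close> and \<open>hessian\<close> are defined indirectly, so they
  are computed by exhibiting candidates; this is how smoothness passes to sample averages.\<close>

lemma twice_continuously_differentiableI:
  fixes f :: "real ^ 'n \<Rightarrow> real"
  assumes G: "\<And>x. GDERIV f x :> G x"
    and H: "\<And>x. (G has_derivative (*v) (H x)) (at x)"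
    and "continuous_on UNIV H"
  shows "twice_continuously_differentiable f" "gradient f = G" "hessian f = H"
proof -
  show grad: "gradient f = G"
    using G gradient_eqI by blast
  show hess: "hessian f = H"
    unfolding fun_eq_iff hessian_def jacobian_def grad
    by (metis frechet_derivative_at[OF H] matrix_of_matrix_vector_mul)
  show "twice_continuously_differentiable f"
    using assms unfolding twice_continuously_differentiable_def grad hess
    by (auto simp: differentiable_def gderiv_def)
qed

lemma
  assumes "twice_continuously_differentiable f"
  shows GDERIV_gradient_C2: "GDERIV f x :> gradient f x"
    and has_derivative_gradient: "(gradient f has_derivative (*v) (hessian f x)) (at x)"
    and continuous_on_hessian: "continuous_on UNIV (hessian f)"
  using assms jacobian_works[of "gradient f" "at x"]
  by (auto simp: twice_continuously_differentiable_def hessian_def intro: GDERIV_gradient)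

lemma twice_continuously_differentiable_sample_avg:
  assumes "\<And>i. i \<in> S \<Longrightarrow> twice_continuously_differentiable (F i)"
  shows "twice_continuously_differentiable (sample_avg F S)"
proof (rule twice_continuously_differentiableI)
  define c where "c = 1 / real (card S)"
  show "GDERIV (sample_avg F S) x :> c *\<^sub>R (\<Sum>i\<in>S. gradient (F i) x)" for x
    using GDERIV_gradient_C2[OF assms] unfolding gderiv_def sample_avg_def c_def[symmetric]
    by (auto intro!: derivative_eq_intros simp: inner_sum_right)
  show "((\<lambda>x. c *\<^sub>R (\<Sum>i\<in>S. gradient (F i) x)) has_derivative
      (*v) (c *\<^sub>R (\<Sum>i\<in>S. hessian (F i) x))) (at x)" for x
  proof -
    have "(\<Sum>i\<in>S. hessian (F i) x) *v h = (\<Sum>i\<in>S. hessian (F i) x *v h)" for h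
      by (induction S rule: infinite_finite_induct) (auto simp: matrix_vector_mult_add_rdistrib)
    then show ?thesis
      using has_derivative_gradient[OF assms]
      by (auto intro!: derivative_eq_intros simp: scaleR_matrix_vector_assoc[symmetric])
  qed
  show "continuous_on UNIV (\<lambda>x. c *\<^sub>R (\<Sum>i\<in>S. hessian (F i) x))"
    by (intro continuous_intros continuous_on_hessian assms)
qed

section \<open>Restriction to lines: symmetry of the Hessian and Taylor expansion\<close>

lemma GDERIV_along_line:
  assumes "\<And>x. GDERIV f x :> G x"
  shows "((\<lambda>s. f (x + s *\<^sub>R u)) has_real_derivative u \<bullet> G (x + s *\<^sub>R u)) (at s)"
proof -
  have "((\<lambda>s. f (x + s *\<^sub>R u)) has_derivative (\<lambda>h. (h *\<^sub>R u) \<bullet> G (x + s *\<^sub>R u))) (at s)"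
    by (rule has_derivative_compose[of "\<lambda>s. x + s *\<^sub>R u" _ _ _ f])
       (use assms in \<open>auto simp: gderiv_def intro!: derivative_eq_intros\<close>)
  then show ?thesis
    by (simp add: has_field_derivative_def mult_commute_abs)
qed

lemma gradient_along_line:
  assumes "twice_continuously_differentiable f"
  shows "((\<lambda>s. u \<bullet> gradient f (x + s *\<^sub>R v)) has_real_derivative
    u \<bullet> (hessian f (x + s *\<^sub>R v) *v v)) (at s)"
proof -
  have "((\<lambda>s. gradient f (x + s *\<^sub>R v)) has_derivative (\<lambda>h. hessian f (x + s *\<^sub>R v) *v (h *\<^sub>R v))) (at s)"
    by (rule has_derivative_compose[of "\<lambda>s. x + s *\<^sub>R v" _ _ _ "gradient f"])
       (use has_derivative_gradient[OF assms] in \<open>auto intro!: derivative_eq_intros\<close>)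
  then have "((\<lambda>s. u \<bullet> gradient f (x + s *\<^sub>R v)) has_derivative
      (\<lambda>h. u \<bullet> (hessian f (x + s *\<^sub>R v) *v (h *\<^sub>R v)))) (at s)"
    by (rule has_derivative_inner_right)
  then show ?thesis
    by (simp add: has_field_derivative_def mult_commute_abs matrix_vector_mult_scaleR)
qed

lemma second_difference_mean_value:
  assumes f: "twice_continuously_differentiable f" and t: "0 < t"
  obtains \<xi> \<eta> where "0 < \<xi>" "\<xi> < t" "0 < \<eta>" "\<eta> < t"
    "f (x + t *\<^sub>R u + t *\<^sub>R v) - f (x + t *\<^sub>R u) - f (x + t *\<^sub>R v) + f x
      = t\<^sup>2 * (u \<bullet> (hessian f (x + \<xi> *\<^sub>R u + \<eta> *\<^sub>R v) *v v))"
proof -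
  \<comment> \<open>The increment \<open>p t - p 0\<close> is the mixed second difference. The mean
    value theorem in direction \<open>u\<close> applied to \<open>p\<close>, and then in direction
    \<open>v\<close> applied to the resulting gradient difference, produces the Hessian.\<close>
  define p where "p s = f (x + t *\<^sub>R v + s *\<^sub>R u) - f (x + s *\<^sub>R u)" for s
  have p': "(p has_real_derivative
      u \<bullet> gradient f (x + t *\<^sub>R v + s *\<^sub>R u) - u \<bullet> gradient f (x + s *\<^sub>R u)) (at s)" for s
    unfolding p_def by (intro DERIV_diff GDERIV_along_line GDERIV_gradient_C2[OF f])
  then obtain \<xi> where \<xi>: "0 < \<xi>" "\<xi> < t"
    "p t - p 0 = (t - 0) * (u \<bullet> gradient f (x + t *\<^sub>R v + \<xi> *\<^sub>R u) - u \<bullet> gradient f (x + \<xi> *\<^sub>R u))"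
    using MVT2[OF t p'] by metis
  obtain \<eta> where \<eta>: "0 < \<eta>" "\<eta> < t"
    "u \<bullet> gradient f (x + \<xi> *\<^sub>R u + t *\<^sub>R v) - u \<bullet> gradient f (x + \<xi> *\<^sub>R u + 0 *\<^sub>R v)
      = (t - 0) * (u \<bullet> (hessian f (x + \<xi> *\<^sub>R u + \<eta> *\<^sub>R v) *v v))"
    using MVT2[OF t gradient_along_line[OF f, of u "x + \<xi> *\<^sub>R u" v]] by metis
  show ?thesis
    by (rule that[OF \<xi>(1,2) \<eta>(1,2)])
       (use \<xi>(3) \<eta>(3) in \<open>simp add: p_def algebra_simps power2_eq_square\<close>)
qed

text \<open>The second difference is symmetric in \<open>u\<close> and \<open>v\<close>, yet the
  mean value theorem expresses it through either order of differentiation. Dividing by the squared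
  step and shrinking it, continuity of the Hessian sends the two expressions to the two
  sides.\<close>

lemma hessian_symmetric_form:
  assumes f: "twice_continuously_differentiable f"
  shows "u \<bullet> (hessian f x *v v) = v \<bullet> (hessian f x *v u)"
proof -
  define t where "t n = 1 / real (Suc n)" for n
  define D where "D n = f (x + t n *\<^sub>R u + t n *\<^sub>R v) - f (x + t n *\<^sub>R u) - f (x + t n *\<^sub>R v) + f x" for n
  have t: "0 < t n" for n by (simp add: t_def)
  have t0: "t \<longlonglongrightarrow> 0"
    unfolding t_def using LIMSEQ_inverse_real_of_nat by (simp add: inverse_eq_divide)
  have lim: "(\<lambda>n. c \<bullet> (hessian f (x + \<xi> n *\<^sub>R a + \<eta> n *\<^sub>R b) *v d)) \<longlonglongrightarrow> c \<bullet> (hessian f x *v d)"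
    if "\<forall>n. 0 < \<xi> n \<and> \<xi> n < t n \<and> 0 < \<eta> n \<and> \<eta> n < t n" for \<xi> \<eta> a b c d
  proof -
    have *: "\<xi> \<longlonglongrightarrow> 0" "\<eta> \<longlonglongrightarrow> 0"
      using that by (auto intro!: tendsto_sandwich[OF _ _ tendsto_const t0] always_eventually less_imp_le)
    have "(\<lambda>n. x + \<xi> n *\<^sub>R a + \<eta> n *\<^sub>R b) \<longlonglongrightarrow> x + 0 *\<^sub>R a + 0 *\<^sub>R b"
      by (intro tendsto_intros *)
    moreover have "isCont (hessian f) x"
      using continuous_on_hessian[OF f] by (simp add: continuous_on_eq_continuous_at)
    ultimately have "(\<lambda>n. hessian f (x + \<xi> n *\<^sub>R a + \<eta> n *\<^sub>R b)) \<longlonglongrightarrow> hessian f x"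
      by (auto intro: isCont_tendsto_compose)
    then show ?thesis
      by (simp add: inner_vec_def matrix_vector_mult_def) (intro tendsto_intros)
  qed
  have "\<forall>n. \<exists>\<xi> \<eta>. (0 < \<xi> \<and> \<xi> < t n \<and> 0 < \<eta> \<and> \<eta> < t n) \<and>
      D n = (t n)\<^sup>2 * (u \<bullet> (hessian f (x + \<xi> *\<^sub>R u + \<eta> *\<^sub>R v) *v v))"
    unfolding D_def using second_difference_mean_value[OF f t] by metis
  then obtain \<xi> \<eta> where 1: "\<forall>n. 0 < \<xi> n \<and> \<xi> n < t n \<and> 0 < \<eta> n \<and> \<eta> n < t n"
      "\<And>n. D n = (t n)\<^sup>2 * (u \<bullet> (hessian f (x + \<xi> n *\<^sub>R u + \<eta> n *\<^sub>R v) *v v))"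
    by metis
  have "D n = f (x + t n *\<^sub>R v + t n *\<^sub>R u) - f (x + t n *\<^sub>R v) - f (x + t n *\<^sub>R u) + f x" for n
    by (simp add: D_def algebra_simps)
  then have "\<forall>n. \<exists>\<xi> \<eta>. (0 < \<xi> \<and> \<xi> < t n \<and> 0 < \<eta> \<and> \<eta> < t n) \<and>
      D n = (t n)\<^sup>2 * (v \<bullet> (hessian f (x + \<xi> *\<^sub>R v + \<eta> *\<^sub>R u) *v u))"
    using second_difference_mean_value[OF f t] by metis
  then obtain \<xi>' \<eta>' where 2: "\<forall>n. 0 < \<xi>' n \<and> \<xi>' n < t n \<and> 0 < \<eta>' n \<and> \<eta>' n < t n"
      "\<And>n. D n = (t n)\<^sup>2 * (v \<bullet> (hessian f (x + \<xi>' n *\<^sub>R v + \<eta>' n *\<^sub>R u) *v u))"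
    by metis
  have "(t n)\<^sup>2 \<noteq> 0" for n using t[of n] by simp
  then have "u \<bullet> (hessian f (x + \<xi> n *\<^sub>R u + \<eta> n *\<^sub>R v) *v v)
      = v \<bullet> (hessian f (x + \<xi>' n *\<^sub>R v + \<eta>' n *\<^sub>R u) *v u)" for n
    using 1(2)[of n] 2(2)[of n] by (metis mult_left_cancel)
  then show ?thesis
    using lim[OF 1(1), of u u v v] lim[OF 2(1), of v v u u] LIMSEQ_unique by (simp, blast)
qed

lemma symmetric_matrix_form:
  fixes A :: "real ^ 'n ^ 'n"
  shows "transpose A = A \<longleftrightarrow> (\<forall>u v. u \<bullet> (A *v v) = v \<bullet> (A *v u))"
proof
  assume "transpose A = A"
  then show "\<forall>u v. u \<bullet> (A *v v) = v \<bullet> (A *v u)"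
    by (metis dot_lmul_matrix inner_commute vector_transpose_matrix)
next
  assume *: "\<forall>u v. u \<bullet> (A *v v) = v \<bullet> (A *v u)"
  have "A $ i $ j = axis i 1 \<bullet> (A *v axis j 1)" for i j
    by (simp add: inner_axis' matrix_vector_mult_basis column_def)
  with * show "transpose A = A"
    by (simp add: vec_eq_iff transpose_def)
qed

lemma transpose_hessian:
  "twice_continuously_differentiable f \<Longrightarrow> transpose (hessian f x) = hessian f x"
  using hessian_symmetric_form symmetric_matrix_form by blast

lemma second_order_Taylor:
  assumes f: "twice_continuously_differentiable f"
  obtains t where "0 < t" "t < 1"
    "f (x + u) = f x + u \<bullet> gradient f x + (u \<bullet> (hessian f (x + t *\<^sub>R u) *v u)) / 2"
proof -
  \<comment> \<open>The restriction of \<open>f\<close> to the segment and its first two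
    derivatives, as the indexed family that \<open>Taylor_up\<close> expects.\<close>
  define d where "d m s = (if m = 0 then f (x + s *\<^sub>R u) else if m = 1 then u \<bullet> gradient f (x + s *\<^sub>R u)
    else u \<bullet> (hessian f (x + s *\<^sub>R u) *v u))" for m :: nat and s
  have "\<forall>m s. m < 2 \<and> 0 \<le> s \<and> s \<le> 1 \<longrightarrow> (d m has_real_derivative d (Suc m) s) (at s)"
    using GDERIV_along_line[OF GDERIV_gradient_C2[OF f]] gradient_along_line[OF f]
    by (auto simp: d_def[abs_def] less_2_cases_iff)
  then obtain t where "0 < t" "t < 1"
    "d 0 1 = (\<Sum>m<2. d m 0 / fact m * (1 - 0) ^ m) + d 2 t / fact 2 * (1 - 0) ^ 2"
    using Taylor_up[of 2 d "d 0" 0 1 0] by auto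
  then show ?thesis
    by (intro that[of t]) (auto simp: d_def numeral_2_eq_2)
qed

section \<open>Diagonalization of real symmetric matrices\<close>

text \<open>A maximizer \<open>x\<close> of the quadratic form on the unit sphere of
  \<open>T\<close> is an eigenvector: the first variation vanishes in all directions of
  \<open>T\<close> orthogonal to \<open>x\<close>, and by invariance the residual
  \<open>A *v x - l *\<^sub>R x\<close> is such a direction.\<close>

lemma symmetric_eigenvector_in_subspace:
  fixes A :: "real ^ 'n ^ 'n"
  assumes sym: "transpose A = A" and T: "subspace T" and inv: "\<And>x. x \<in> T \<Longrightarrow> A *v x \<in> T"
    and "T \<noteq> {0}"
  obtains x l where "x \<in> T" "norm x = 1" "A *v x = l *\<^sub>R x"
proof -
  have dot: "u \<bullet> (A *v v) = v \<bullet> (A *v u)" for u v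
    using sym symmetric_matrix_form by blast
  let ?K = "T \<inter> sphere 0 1"
  obtain z where z: "z \<in> T" "z \<noteq> 0"
    using \<open>T \<noteq> {0}\<close> subspace_0[OF T] by auto
  then have "z /\<^sub>R norm z \<in> ?K"
    by (simp add: subspace_scale[OF T])
  then have ne: "?K \<noteq> {}" by blast
  have "compact ?K"
    using closed_subspace[OF T] by (simp add: closed_Int_compact)
  moreover have "continuous_on ?K (\<lambda>x. x \<bullet> (A *v x))"
    by (intro continuous_intros matrix_vector_mult_linear_continuous_on)
  ultimately obtain x where x: "x \<in> ?K" and max: "\<And>y. y \<in> ?K \<Longrightarrow> y \<bullet> (A *v y) \<le> x \<bullet> (A *v x)"
    using continuous_attains_sup[OF _ ne, of "\<lambda>x. x \<bullet> (A *v x)"] by metis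
  define l where "l = x \<bullet> (A *v x)"
  have xx: "x \<in> T" "x \<bullet> x = 1" using x by (auto simp: norm_eq_1)
  have le: "y \<bullet> (A *v y) \<le> l * (y \<bullet> y)" if "y \<in> T" for y
  proof (cases "y = 0")
    case False
    then have "(y /\<^sub>R norm y) \<bullet> (A *v (y /\<^sub>R norm y)) \<le> l"
      unfolding l_def by (intro max) (simp add: subspace_scale[OF T that])
    then show ?thesis
      using False by (simp add: matrix_vector_mult_scaleR field_simps power2_norm_eq_inner[symmetric] power2_eq_square)
  qed simp
  have orth: "y \<bullet> (A *v x) = 0" if y: "y \<in> T" "y \<bullet> x = 0" for y
  proof (rule ccontr)
    assume ne: "y \<bullet> (A *v x) \<noteq> 0"
    define b where "b = y \<bullet> (A *v x)"
    define c where "c = l * (y \<bullet> y) - y \<bullet> (A *v y)"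
    \<comment> \<open>Maximality at the perturbed point \<open>x + t *\<^sub>R y\<close>: a nonzero
      linear term would dominate the quadratic one for small \<open>t\<close>.\<close>
    have quad: "2 * t * b \<le> t\<^sup>2 * c" for t
    proof -
      have "x + t *\<^sub>R y \<in> T" using xx y T by (simp add: subspace_add subspace_scale)
      from le[OF this] have "l + 2 * t * b + t\<^sup>2 * (y \<bullet> (A *v y)) \<le> l * (1 + t\<^sup>2 * (y \<bullet> y))"
        using xx y dot[of x y]
        by (simp add: matrix_vector_right_distrib matrix_vector_mult_scaleR inner_add_left
            inner_add_right l_def b_def inner_commute[of x y] power2_eq_square algebra_simps)
      then show ?thesis by (simp add: c_def algebra_simps)
    qed
    have c: "0 \<le> c" using le[OF y(1)] by (simp add: c_def)
    \<comment> \<open>This choice turns \<open>quad\<close> into \<open>2 * (c + 1) \<le> c\<close>,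
      impossible for nonnegative \<open>c\<close>; adding 1 keeps the denominator positive.\<close>
    define t where "t = b / (c + 1)"
    have "b = t * (c + 1)" using c by (simp add: t_def)
    then have "t\<^sup>2 * (2 * (c + 1)) \<le> t\<^sup>2 * c" and "t \<noteq> 0"
      using quad[of t] ne by (auto simp: b_def power2_eq_square algebra_simps)
    then have "2 * (c + 1) \<le> c"
      by (metis mult_le_cancel_left_pos zero_less_power2)
    with c show False by simp
  qed
  define y where "y = A *v x - l *\<^sub>R x"
  have y: "y \<in> T" "y \<bullet> x = 0"
    using xx T inv by (auto simp: y_def l_def subspace_diff subspace_scale inner_diff_right inner_commute)
  have "y \<bullet> y = y \<bullet> (A *v x) - l * (y \<bullet> x)"
    by (subst (2) y_def) (simp add: inner_diff_right)
  then have "y = 0" using orth[OF y] y by simp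
  then show ?thesis
    using that[of x l] x by (simp add: y_def)
qed

text \<open>An orthonormal set of eigenvectors of maximal cardinality is a basis, because its orthogonal
  complement is invariant and would otherwise contain a further eigenvector.\<close>

lemma symmetric_orthonormal_eigenbasis:
  fixes A :: "real ^ 'n ^ 'n"
  assumes sym: "transpose A = A"
  obtains B where "pairwise orthogonal B" "\<And>b. b \<in> B \<Longrightarrow> norm b = 1"
    "\<And>b. b \<in> B \<Longrightarrow> \<exists>l. A *v b = l *\<^sub>R b" "finite B" "card B = CARD('n)"
proof -
  define P where "P B \<longleftrightarrow> pairwise orthogonal B \<and> (\<forall>b\<in>B. norm b = 1 \<and> (\<exists>l. A *v b = l *\<^sub>R b))"
    for B :: "(real ^ 'n) set"
  \<comment> \<open>Independence bounds the cardinality by the dimension, so a set of maximal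
    cardinality exists.\<close>
  have indep: "independent B" if "P B" for B
    using that by (intro pairwise_orthogonal_independent) (auto simp: P_def)
  have bound: "card B \<le> CARD('n)" if "P B" for B
    using independent_bound[OF indep[OF that]] by simp
  have "P {}" by (simp add: P_def)
  then obtain B where B: "P B" and max: "\<And>C. P C \<Longrightarrow> card C \<le> card B"
    using ex_has_greatest_nat[of P "{}" card "Suc CARD('n)"] bound by (metis less_Suc_eq_le)
  have fin: "finite B"
    using independent_bound[OF indep[OF B]] by simp
  define T where "T = {y. \<forall>x\<in>B. orthogonal x y}"
  have T: "subspace T" unfolding T_def by (rule subspace_orthogonal_to_vectors)
  have inv: "A *v y \<in> T" if y: "y \<in> T" for y
  proof -
    have "b \<bullet> (A *v y) = 0" if "b \<in> B" for b
    proof -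
      have "\<exists>l. A *v b = l *\<^sub>R b" using B that by (simp add: P_def)
      then obtain l where l: "A *v b = l *\<^sub>R b" ..
      have "b \<bullet> (A *v y) = y \<bullet> (A *v b)" using sym symmetric_matrix_form by blast
      also have "\<dots> = l * (b \<bullet> y)" by (simp add: l inner_commute[of y])
      finally show ?thesis
        using y that by (simp add: T_def orthogonal_def)
    qed
    then show ?thesis by (simp add: T_def orthogonal_def)
  qed
  have "T = {0}"
  proof (rule ccontr)
    assume "T \<noteq> {0}"
    then obtain x l where x: "x \<in> T" "norm x = 1" "A *v x = l *\<^sub>R x"
      using symmetric_eigenvector_in_subspace[OF sym T inv] by blast
    have "x \<notin> B"
      using x by (auto simp: T_def orthogonal_def norm_eq_1)
    moreover have "P (insert x B)"
      using B x by (auto simp: P_def T_def pairwise_insert orthogonal_commute)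
    ultimately show False
      using max[of "insert x B"] fin by simp
  qed
  have "card B = CARD('n)"
  proof (rule ccontr)
    assume "card B \<noteq> CARD('n)"
    then have "dim B < DIM(real ^ 'n)"
      using bound[OF B] dim_eq_card_independent[OF indep[OF B]] by simp
    then obtain x where "x \<noteq> 0" "\<And>y. y \<in> span B \<Longrightarrow> orthogonal x y"
      using orthogonal_to_subspace_exists by blast
    then have "x \<in> T"
      by (auto simp: T_def orthogonal_commute span_base)
    with \<open>x \<noteq> 0\<close> \<open>T = {0}\<close> show False by simp
  qed
  with fin B show ?thesis
    by (intro that[of B]) (auto simp: P_def)
qed

lemma matrix_mult_diag_matrix:
  fixes A :: "real ^ 'n ^ 'n"
  shows "(A ** diag_matrix l) $ i $ j = A $ i $ j * l $ j"
  by (simp add: matrix_matrix_mult_def diag_matrix_def if_distrib[of "\<lambda>x. x * _"]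
      if_distrib[of "(*) _"] cong: if_cong)

lemma diag_matrix_mult_matrix:
  fixes A :: "real ^ 'n ^ 'n"
  shows "(diag_matrix l ** A) $ i $ j = l $ i * A $ i $ j"
  by (simp add: matrix_matrix_mult_def diag_matrix_def if_distrib[of "\<lambda>x. x * _"]
      if_distrib[of "(*) _"] cong: if_cong)

lemma diag_matrix_mult_vec: "(diag_matrix l *v x) $ i = l $ i * x $ i"
  by (simp add: matrix_vector_mult_def diag_matrix_def if_distrib[of "\<lambda>x. x * _"]
      if_distrib[of "(*) _"] cong: if_cong)

lemma transpose_diag_matrix: "transpose (diag_matrix l) = diag_matrix l"
  by (simp add: diag_matrix_def transpose_def vec_eq_iff)

theorem symmetric_diagonalization:
  fixes A :: "real ^ 'n ^ 'n"
  assumes sym: "transpose A = A"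
  obtains U l where "orthogonal_matrix U" "A = U ** diag_matrix l ** transpose U"
proof -
  obtain B where B: "pairwise orthogonal B" "\<And>b. b \<in> B \<Longrightarrow> norm b = 1"
    "\<And>b. b \<in> B \<Longrightarrow> \<exists>l. A *v b = l *\<^sub>R b" "finite B" "card B = CARD('n)"
    using symmetric_orthonormal_eigenbasis[OF sym] by metis
  obtain e where e: "bij_betw e (UNIV :: 'n set) B"
    using finite_same_card_bij[of "UNIV :: 'n set" B] B by auto
  have eB: "e i \<in> B" for i using e by (auto simp: bij_betw_def)
  obtain l where l: "\<And>i. A *v e i = l i *\<^sub>R e i"
    using B(3)[OF eB] by metis
  define U :: "real ^ 'n ^ 'n" where "U = (\<chi> i j. e j $ i)"
  have col: "column j U = e j" for j by (simp add: U_def column_def vec_eq_iff)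
  have "orthogonal (e i) (e j)" if "i \<noteq> j" for i j
    using B(1) eB that bij_betw_imp_inj_on[OF e] unfolding pairwise_def by (metis injD)
  then have U: "orthogonal_matrix U"
    using B(2) eB by (simp add: orthogonal_matrix_orthonormal_columns col)
  \<comment> \<open>Column by column, the eigenvector equations say that \<open>A ** U\<close> is
    \<open>U\<close> with scaled columns.\<close>
  have "(A ** U) $ i $ j = (A *v e j) $ i" for i j
    by (simp add: U_def matrix_matrix_mult_def matrix_vector_mult_def)
  then have "A ** U = U ** diag_matrix (vec_lambda l)"
    by (simp add: vec_eq_iff matrix_mult_diag_matrix l) (simp add: U_def)
  then have "A ** U ** transpose U = U ** diag_matrix (vec_lambda l) ** transpose U" by simp
  then have "A = U ** diag_matrix (vec_lambda l) ** transpose U"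
    using U by (simp add: orthogonal_matrix_def flip: matrix_mul_assoc)
  with U show ?thesis using that by blast
qed

text \<open>The conjugating matrix \<open>V\<^sup>T U\<close> only links equal diagonal entries, so it also intertwines any
  function of the two diagonals.\<close>

lemma diagonalization_abs_unique:
  fixes U V :: "real ^ 'n ^ 'n"
  assumes U: "orthogonal_matrix U" and V: "orthogonal_matrix V"
    and eq: "U ** diag_matrix l ** transpose U = V ** diag_matrix m ** transpose V"
  shows "U ** diag_matrix (\<chi> i. \<bar>l $ i\<bar>) ** transpose U
    = V ** diag_matrix (\<chi> i. \<bar>m $ i\<bar>) ** transpose V"
proof -
  let ?l = "\<chi> i. \<bar>l $ i\<bar>" and ?m = "\<chi> i. \<bar>m $ i\<bar>"
  define W where "W = transpose V ** U"
  have UU: "transpose U ** U = mat 1" "U ** transpose U = mat 1"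
    and VV: "transpose V ** V = mat 1" "V ** transpose V = mat 1"
    using U V by (auto simp: orthogonal_matrix_def)
  have "W ** diag_matrix l = transpose V ** (U ** diag_matrix l ** transpose U) ** U"
    unfolding W_def by (simp add: UU flip: matrix_mul_assoc)
  also have "\<dots> = transpose V ** V ** diag_matrix m ** W"
    unfolding eq W_def by (simp add: matrix_mul_assoc)
  finally have "W ** diag_matrix l = diag_matrix m ** W"
    by (simp add: VV)
  then have "W $ i $ j * l $ j = m $ i * W $ i $ j" for i j
    by (metis matrix_mult_diag_matrix diag_matrix_mult_matrix)
  then have "W $ i $ j = 0 \<or> l $ j = m $ i" for i j
    by (metis mult.commute mult_cancel_left)
  then have W: "W ** diag_matrix ?l = diag_matrix ?m ** W"
    by (simp add: vec_eq_iff matrix_mult_diag_matrix diag_matrix_mult_matrix)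
       (metis mult.commute mult_zero_left)
  have "U ** diag_matrix ?l ** transpose U = V ** (W ** diag_matrix ?l) ** transpose U"
    unfolding W_def by (simp add: VV matrix_mul_assoc)
  also have "\<dots> = V ** (diag_matrix ?m ** W) ** transpose U"
    by (simp only: W)
  also have "\<dots> = V ** diag_matrix ?m ** transpose V ** (U ** transpose U)"
    unfolding W_def by (simp add: matrix_mul_assoc)
  finally show ?thesis
    by (simp add: UU)
qed

text \<open>The spectral theorem gives existence and \<open>diagonalization_abs_unique\<close> gives
  uniqueness for the description in \<open>matrix_abs\<close>; symmetry is then visible from the
  factorization.\<close>

lemma transpose_matrix_abs:
  assumes "transpose A = A"
  shows "transpose (matrix_abs A) = matrix_abs A"
proof -
  obtain U l where Ul: "orthogonal_matrix U" "A = U ** diag_matrix l ** transpose U"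
    using symmetric_diagonalization[OF assms] by metis
  have "matrix_abs A = U ** diag_matrix (\<chi> i. \<bar>l $ i\<bar>) ** transpose U"
    unfolding matrix_abs_def
    by (rule the_equality) (use Ul diagonalization_abs_unique in metis)+
  then show ?thesis
    by (simp add: matrix_transpose_mul transpose_diag_matrix matrix_mul_assoc)
qed

section \<open>Loewner bounds and the modified Hessian\<close>

lemma mat_mult_vec: "mat c *v v = c *\<^sub>R (v :: real ^ 'n)"
  by (simp add: vec_eq_iff matrix_vector_mult_def mat_def if_distrib[of "\<lambda>x. x * _"]
      if_distrib[of "(*) _"] cong: if_cong)

lemma loewner_le_mat_left: "mat c \<preceq> A \<longleftrightarrow> (\<forall>v. c * (v \<bullet> v) \<le> v \<bullet> (A *v v))"
  by (simp add: loewner_le_def mat_mult_vec)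

lemma loewner_le_mat_right: "A \<preceq> mat c \<longleftrightarrow> (\<forall>v. v \<bullet> (A *v v) \<le> c * (v \<bullet> v))"
  by (simp add: loewner_le_def mat_mult_vec)

lemma mat_loewner_le_mat:
  fixes A :: "real ^ 'n ^ 'n"
  assumes "mat s \<preceq> A" "A \<preceq> mat t"
  shows "s \<le> t"
proof -
  let ?e = "axis undefined 1 :: real ^ 'n"
  have "s * (?e \<bullet> ?e) \<le> t * (?e \<bullet> ?e)"
    using assms unfolding loewner_le_mat_left loewner_le_mat_right by (meson order_trans)
  then show ?thesis by (simp add: inner_axis_axis)
qed

text \<open>In the coordinates of an eigenbasis the quadratic form is a sum of squares weighted by
  the eigenvalues, each at least the smallest one.\<close>

lemma mat_lambda_min_loewner_le:
  fixes A :: "real ^ 'n ^ 'n"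
  assumes "transpose A = A"
  shows "mat (lambda_min A) \<preceq> A"
proof -
  obtain U m where U: "orthogonal_matrix U" and A: "A = U ** diag_matrix m ** transpose U"
    using symmetric_diagonalization[OF assms] by metis
  define W where "W = transpose U"
  have UU: "W ** U = mat 1" "U ** W = mat 1"
    using U by (auto simp: W_def orthogonal_matrix_def)
  have Av: "A *v v = U *v (diag_matrix m *v (W *v v))" for v
    by (simp add: A W_def[symmetric] matrix_vector_mul_assoc matrix_mul_assoc)
  \<comment> \<open>Identifying the eigenvalues with the diagonal entries shows that
    \<open>Min\<close> ranges over a finite nonempty set.\<close>
  have eig: "{l. \<exists>v. v \<noteq> 0 \<and> A *v v = l *\<^sub>R v} = range (($) m)"
  proof (intro equalityI subsetI)
    fix l assume "l \<in> {l. \<exists>v. v \<noteq> 0 \<and> A *v v = l *\<^sub>R v}"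
    then obtain v where v: "v \<noteq> 0" "A *v v = l *\<^sub>R v" by blast
    define z where "z = W *v v"
    have vz: "v = U *v z" by (simp add: z_def matrix_vector_mul_assoc UU)
    have "diag_matrix m *v z = W *v (A *v v)"
      unfolding Av z_def by (simp add: matrix_vector_mul_assoc matrix_mul_assoc UU)
    also have "\<dots> = l *\<^sub>R z"
      unfolding v(2) z_def by (rule matrix_vector_mult_scaleR)
    finally have "m $ i * z $ i = l * z $ i" for i
      by (metis diag_matrix_mult_vec vector_scaleR_component real_scaleR_def)
    moreover have "z \<noteq> 0" using v(1) vz by auto
    then obtain i where "z $ i \<noteq> 0" by (auto simp: vec_eq_iff)
    ultimately show "l \<in> range (($) m)" by (metis mult_right_cancel rangeI)
  next
    fix l assume "l \<in> range (($) m)"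
    then obtain i where i: "l = m $ i" by blast
    let ?v = "U *v axis i 1"
    have 1: "W *v ?v = axis i 1" by (simp add: matrix_vector_mul_assoc UU)
    have "A *v ?v = U *v (diag_matrix m *v axis i 1)" unfolding Av 1 ..
    also have "diag_matrix m *v axis i 1 = l *\<^sub>R axis i 1"
      by (simp add: vec_eq_iff diag_matrix_mult_vec i axis_def)
    finally have "A *v ?v = l *\<^sub>R ?v" by (simp add: matrix_vector_mult_scaleR)
    moreover have "?v \<noteq> 0" using 1 by (metis axis_eq_0_iff matrix_vector_mult_0_right zero_neq_one)
    ultimately show "l \<in> {l. \<exists>v. v \<noteq> 0 \<and> A *v v = l *\<^sub>R v}" by blast
  qed
  have le: "lambda_min A \<le> m $ i" for i
    unfolding lambda_min_def eig by simp
  have "lambda_min A * (v \<bullet> v) \<le> v \<bullet> (A *v v)" for v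
  proof -
    define z where "z = W *v v"
    have vz: "v = U *v z" by (simp add: z_def matrix_vector_mul_assoc UU)
    have inner: "(U *v a) \<bullet> (U *v b) = a \<bullet> b" for a b
      by (metis UU(1) W_def dot_lmul_matrix matrix_vector_mul_assoc matrix_vector_mul_lid transpose_matrix_vector)
    have "v \<bullet> (A *v v) = z \<bullet> (diag_matrix m *v z)"
      unfolding Av z_def[symmetric] by (subst vz) (rule inner)
    also have "\<dots> = (\<Sum>i\<in>UNIV. m $ i * (z $ i * z $ i))"
      by (simp add: inner_vec_def diag_matrix_mult_vec mult_ac)
    also have "\<dots> \<ge> (\<Sum>i\<in>UNIV. lambda_min A * (z $ i * z $ i))"
      by (intro sum_mono mult_right_mono le) simp
    finally show ?thesis
      by (simp add: vz inner) (simp add: inner_vec_def sum_distrib_left)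
  qed
  then show ?thesis by (simp add: loewner_le_mat_left)
qed

lemma
  assumes "transpose H = H"
  shows transpose_hess_mod: "transpose (hess_mod c H) = hess_mod c H"
    and mat_loewner_le_hess_mod: "mat c \<preceq> hess_mod c H"
proof -
  have tr: "transpose (matrix_abs H + mat d) = matrix_abs H + mat d" for d
    using transpose_matrix_abs[OF assms] by (simp add: transpose_def vec_eq_iff mat_def) 
  show "transpose (hess_mod c H) = hess_mod c H"
    using transpose_matrix_abs[OF assms] tr by (simp add: hess_mod_def)
  have le: "lambda_min (matrix_abs H) * (v \<bullet> v) \<le> v \<bullet> (matrix_abs H *v v)" for v
    using mat_lambda_min_loewner_le[OF transpose_matrix_abs[OF assms]]
    by (simp add: loewner_le_mat_left)
  have "c * (v \<bullet> v) \<le> v \<bullet> (hess_mod c H *v v)" for v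
  proof (cases "c \<le> lambda_min (matrix_abs H)")
    case True
    then have "c * (v \<bullet> v) \<le> lambda_min (matrix_abs H) * (v \<bullet> v)"
      by (simp add: mult_right_mono)
    then show ?thesis using True le[of v] by (simp add: hess_mod_def)
  next
    case False
    then show ?thesis using le[of v]
      by (simp add: hess_mod_def matrix_vector_mult_add_rdistrib inner_add_right mat_mult_vec algebra_simps)
  qed
  then show "mat c \<preceq> hess_mod c H" by (simp add: loewner_le_mat_left)
qed

section \<open>Preconditioned gradient steps\<close>

lemma matrix_inv_works:
  assumes "invertible A"
  shows "A ** matrix_inv A = mat 1" "matrix_inv A ** A = mat 1"
  using someI_ex[OF assms[unfolded invertible_def]] unfolding matrix_inv_def by auto

text \<open>Writing \<open>v\<close> as \<open>Q *v (matrix_inv Q *v v)\<close> turns the first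
  three claims into symmetry, coercivity and nonnegativity of \<open>Q\<close>. The upper bound
  comes from one nonnegative square, without diagonalizing \<open>Q\<close>.\<close>

lemma
  fixes Q :: "real ^ 'n ^ 'n"
  assumes sym: "transpose Q = Q" and c: "0 < c" "mat c \<preceq> Q"
  shows matrix_inv_form_symmetric: "u \<bullet> (matrix_inv Q *v v) = v \<bullet> (matrix_inv Q *v u)"
    and matrix_inv_form_lower:
      "c * ((matrix_inv Q *v v) \<bullet> (matrix_inv Q *v v)) \<le> v \<bullet> (matrix_inv Q *v v)"
    and matrix_inv_form_nonneg: "0 \<le> v \<bullet> (matrix_inv Q *v v)"
    and matrix_inv_form_upper: "Q \<preceq> mat m \<Longrightarrow> v \<bullet> v \<le> m * (v \<bullet> (matrix_inv Q *v v))"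
proof -
  let ?P = "matrix_inv Q"
  have low: "c * (x \<bullet> x) \<le> x \<bullet> (Q *v x)" for x
    using c(2) by (simp add: loewner_le_mat_left)
  have pos: "0 \<le> x \<bullet> (Q *v x)" for x
    using low[of x] c(1) by (meson inner_ge_zero less_imp_le mult_nonneg_nonneg order_trans)
  \<comment> \<open>Coercivity makes the kernel trivial, hence \<open>Q\<close> invertible.\<close>
  have "x = 0" if "Q *v x = 0" for x
  proof -
    have "x \<bullet> x \<le> 0"
      using low[of x] c(1) that by (simp add: mult_le_0_iff)
    then show ?thesis
      by (metis inner_gt_zero_iff not_less)
  qed
  then have "invertible Q"
    by (metis invertible_left_inverse matrix_left_invertible_ker)
  then have QP: "Q *v (?P *v x) = x" for x
    by (simp add: matrix_vector_mul_assoc matrix_inv_works)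
  have dot: "x \<bullet> (Q *v y) = y \<bullet> (Q *v x)" for x y
    using sym symmetric_matrix_form by blast
  show "u \<bullet> (?P *v v) = v \<bullet> (?P *v u)"
    by (metis QP dot inner_commute)
  show lower: "c * ((?P *v v) \<bullet> (?P *v v)) \<le> v \<bullet> (?P *v v)"
    by (metis QP low inner_commute)
  show "0 \<le> v \<bullet> (?P *v v)"
    by (metis QP pos inner_commute)
  show "v \<bullet> v \<le> m * (v \<bullet> (?P *v v))" if m: "Q \<preceq> mat m"
  proof -
    have up: "x \<bullet> (Q *v x) \<le> m * (x \<bullet> x)" for x
      using m by (simp add: loewner_le_mat_right)
    have "0 < m"
      using c(1) mat_loewner_le_mat[OF c(2) m] by simp
    let ?y = "?P *v v"
    \<comment> \<open>The left side is nonnegative, and the last term on the right is at most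
      \<open>m * (v \<bullet> v)\<close>; what remains is the claim multiplied by
      \<open>m\<close>.\<close>
    have "(m *\<^sub>R ?y - v) \<bullet> (Q *v (m *\<^sub>R ?y - v))
        = m * (m * (v \<bullet> ?y)) - 2 * m * (v \<bullet> v) + v \<bullet> (Q *v v)"
      using dot[of ?y v]
      by (simp add: matrix_vector_mult_diff_distrib matrix_vector_mult_scaleR QP inner_diff_left
          inner_diff_right inner_commute[of ?y v] right_diff_distrib)
    then have "m * (v \<bullet> v) \<le> m * (m * (v \<bullet> ?y))"
      using pos[of "m *\<^sub>R ?y - v"] up[of v] by simp
    with \<open>0 < m\<close> show ?thesis by simp
  qed
qed

section \<open>One-step descent and the perturbed recursion\<close>

lemma quadratic_upper_bound:
  assumes "twice_continuously_differentiable f" "\<And>x. hessian f x \<preceq> mat L"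
  shows "f (x + u) \<le> f x + u \<bullet> gradient f x + L / 2 * (u \<bullet> u)"
proof -
  obtain t where "f (x + u) = f x + u \<bullet> gradient f x + (u \<bullet> (hessian f (x + t *\<^sub>R u) *v u)) / 2"
    using second_order_Taylor[OF assms(1)] by metis
  moreover have "u \<bullet> (hessian f (x + t *\<^sub>R u) *v u) \<le> L * (u \<bullet> u)"
    using assms(2) by (simp add: loewner_le_mat_right)
  ultimately show ?thesis by simp
qed

text \<open>Strong convexity bounds \<open>f y\<close> below by a quadratic model around
  \<open>x\<close>; completing the square shows that the model never drops by more than the squared
  gradient norm over \<open>2 * \<mu>\<close>.\<close>

lemma Polyak_Lojasiewicz:
  assumes f: "twice_continuously_differentiable f" and "0 < \<mu>" "\<And>x. mat \<mu> \<preceq> hessian f x"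
  shows "2 * \<mu> * (f x - f y) \<le> gradient f x \<bullet> gradient f x"
proof -
  define u where "u = y - x"
  let ?g = "gradient f x"
  obtain t where "f (x + u) = f x + u \<bullet> ?g + (u \<bullet> (hessian f (x + t *\<^sub>R u) *v u)) / 2"
    using second_order_Taylor[OF f] by metis
  moreover have "\<mu> * (u \<bullet> u) \<le> u \<bullet> (hessian f (x + t *\<^sub>R u) *v u)"
    using assms(3) by (simp add: loewner_le_mat_left)
  ultimately have "f x - f y \<le> - (u \<bullet> ?g) - \<mu> / 2 * (u \<bullet> u)"
    by (simp add: u_def)
  then have "2 * \<mu> * (f x - f y) \<le> 2 * \<mu> * (- (u \<bullet> ?g) - \<mu> / 2 * (u \<bullet> u))"
    using \<open>0 < \<mu>\<close> by simp
  also have "\<dots> = ?g \<bullet> ?g - (\<mu> *\<^sub>R u + ?g) \<bullet> (\<mu> *\<^sub>R u + ?g)"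
    by (simp add: inner_add_left inner_add_right inner_commute algebra_simps)
  also have "\<dots> \<le> ?g \<bullet> ?g" by simp
  finally show ?thesis .
qed

lemma preconditioned_step_decrease:
  assumes f: "twice_continuously_differentiable f" and L: "\<And>x. hessian f x \<preceq> mat L"
    and Q: "transpose Q = Q" "0 < c" "mat c \<preceq> Q"
    and \<alpha>: "0 \<le> \<alpha>" "\<alpha> * L \<le> c"
  defines "P \<equiv> matrix_inv Q"
  shows "f (x - \<alpha> *\<^sub>R (P *v g)) \<le> f x + \<alpha> / 2 *
    ((mat_norm P (g - gradient f x))\<^sup>2 - (mat_norm P (gradient f x))\<^sup>2)"
proof -
  let ?d = "gradient f x"
  have sq: "(mat_norm P v)\<^sup>2 = v \<bullet> (P *v v)" for v
    using matrix_inv_form_nonneg[OF Q] by (simp add: mat_norm_def P_def)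
  have "\<alpha> * L * ((P *v g) \<bullet> (P *v g)) \<le> c * ((P *v g) \<bullet> (P *v g))"
    using \<alpha> by (intro mult_right_mono) auto
  also have "\<dots> \<le> g \<bullet> (P *v g)"
    unfolding P_def by (rule matrix_inv_form_lower[OF Q])
  finally have *: "\<alpha> * (\<alpha> * L * ((P *v g) \<bullet> (P *v g))) \<le> \<alpha> * (g \<bullet> (P *v g))"
    using \<alpha> by (simp add: mult_left_mono)
  have "f (x - \<alpha> *\<^sub>R (P *v g)) \<le> f x - \<alpha> * (?d \<bullet> (P *v g)) + L / 2 * (\<alpha> * \<alpha> * ((P *v g) \<bullet> (P *v g)))"
    using quadratic_upper_bound[OF f L, of x "- (\<alpha> *\<^sub>R (P *v g))"]
    by (simp add: inner_commute[of ?d] mult.assoc)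
  also have "\<dots> \<le> f x - \<alpha> * (?d \<bullet> (P *v g)) + \<alpha> / 2 * (g \<bullet> (P *v g))"
    using * by (simp add: algebra_simps)
  \<comment> \<open>Polarization in the inner product of \<open>P\<close>: twice the cross term of
    \<open>g\<close> and the gradient is traded for the squared norm of their difference.\<close>
  also have "\<dots> = f x + \<alpha> / 2 * ((g - ?d) \<bullet> (P *v (g - ?d)) - ?d \<bullet> (P *v ?d))"
    using matrix_inv_form_symmetric[OF Q, of g ?d]
    by (simp add: P_def matrix_vector_mult_diff_distrib inner_diff_left inner_diff_right algebra_simps)
  finally show ?thesis by (simp add: sq)
qed

lemma preconditioned_step_contraction:
  assumes f: "twice_continuously_differentiable f" and L: "\<And>x. hessian f x \<preceq> mat L"
    and \<mu>: "0 < \<mu>" "\<And>x. mat \<mu> \<preceq> hessian f x"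
    and Q: "transpose Q = Q" "0 < c" "mat c \<preceq> Q" and m: "0 < m" "Q \<preceq> mat m"
    and \<alpha>: "0 \<le> \<alpha>" "\<alpha> * L \<le> c" and \<theta>: "\<theta>\<^sup>2 \<le> 1"
    and err: "(mat_norm (matrix_inv Q) (g - gradient f x))\<^sup>2
      \<le> \<theta>\<^sup>2 * (mat_norm (matrix_inv Q) (gradient f x))\<^sup>2 + \<epsilon>"
  shows "f (x - \<alpha> *\<^sub>R (matrix_inv Q *v g)) - f y
    \<le> (1 - \<alpha> * \<mu> * (1 - \<theta>\<^sup>2) / m) * (f x - f y) + \<alpha> / 2 * \<epsilon>"
proof -
  define G where "G = (mat_norm (matrix_inv Q) (gradient f x))\<^sup>2"
  have G: "G = gradient f x \<bullet> (matrix_inv Q *v gradient f x)"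
    using matrix_inv_form_nonneg[OF Q] by (simp add: G_def mat_norm_def)
  \<comment> \<open>The Polyak-Lojasiewicz inequality is Euclidean; passing to the norm of the
    inverse of \<open>Q\<close> costs the factor \<open>m\<close>.\<close>
  have "2 * \<mu> * (f x - f y) \<le> m * G"
    using Polyak_Lojasiewicz[OF f \<mu>] matrix_inv_form_upper[OF Q m(2)] unfolding G
    by (rule order_trans)
  then have "2 * \<mu> / m * (f x - f y) \<le> G"
    using m(1) by (simp add: field_simps)
  \<comment> \<open>The factor is the coefficient of \<open>- G\<close> left in the decrease after
    the relative error has taken its share \<theta>^2.\<close>
  then have "\<alpha> / 2 * (1 - \<theta>\<^sup>2) * (2 * \<mu> / m * (f x - f y)) \<le> \<alpha> / 2 * (1 - \<theta>\<^sup>2) * G"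
    using \<alpha> \<theta> by (intro mult_left_mono) auto
  moreover have "f (x - \<alpha> *\<^sub>R (matrix_inv Q *v g)) \<le> f x + \<alpha> / 2 * (\<theta>\<^sup>2 * G + \<epsilon> - G)"
    using preconditioned_step_decrease[OF f L Q \<alpha>, of x g] err \<alpha>
    unfolding G_def[symmetric] by (smt (verit) divide_nonneg_nonneg mult_left_mono)
  moreover have "\<alpha> / 2 * (\<theta>\<^sup>2 * G + \<epsilon> - G) = \<alpha> / 2 * \<epsilon> - \<alpha> / 2 * (1 - \<theta>\<^sup>2) * G"
    by (simp add: algebra_simps)
  moreover have "\<alpha> / 2 * (1 - \<theta>\<^sup>2) * (2 * \<mu> / m * (f x - f y))
      = \<alpha> * \<mu> * (1 - \<theta>\<^sup>2) / m * (f x - f y)"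
    by simp
  ultimately show ?thesis by (simp only: left_diff_distrib mult_1)
qed

text \<open>Half of the contraction \<open>q\<close> absorbs the geometrically decaying perturbation.\<close>

lemma perturbed_linear_convergence:
  fixes \<phi> \<epsilon> :: "nat \<Rightarrow> real"
  assumes rec: "\<And>k. \<phi> (Suc k) \<le> (1 - q) * \<phi> k + r * \<epsilon> k"
    and \<epsilon>: "\<And>k. \<epsilon> (Suc k) = \<epsilon> k * a"
    and q: "q \<le> 1" and a: "0 \<le> a" and C: "0 \<le> C" "\<phi> 0 \<le> C"
    and r: "0 \<le> r * \<epsilon> 0" "r * \<epsilon> 0 \<le> q / 2 * C"
  shows "\<phi> k \<le> C * max (1 - q / 2) a ^ k"
proof (induction k)
  case (Suc k)
  let ?\<rho> = "max (1 - q / 2) a"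
  have "\<epsilon> k = \<epsilon> 0 * a ^ k" by (induction k) (auto simp: \<epsilon>)
  then have "r * \<epsilon> k = r * \<epsilon> 0 * a ^ k" by simp
  \<comment> \<open>Since \<open>a \<le> ?\<rho>\<close>, the perturbation decays at least as fast
    as the target rate.\<close>
  also have "\<dots> \<le> r * \<epsilon> 0 * ?\<rho> ^ k"
    using a r by (intro mult_left_mono power_mono) auto
  also have "\<dots> \<le> q / 2 * C * ?\<rho> ^ k"
    using a r by (intro mult_right_mono) auto
  \<comment> \<open>Multiplying the induction hypothesis by \<open>1 - q\<close> uses
    \<open>q \<le> 1\<close>. The coefficients \<open>1 - q\<close> and \<open>q / 2\<close> then
    add up to \<open>1 - q / 2\<close>.\<close>
  finally have "\<phi> (Suc k) \<le> (1 - q) * (C * ?\<rho> ^ k) + q / 2 * C * ?\<rho> ^ k"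
    using rec[of k] mult_left_mono[OF Suc.IH, of "1 - q"] q by linarith
  also have "\<dots> = (1 - q / 2) * (C * ?\<rho> ^ k)"
    by (simp add: algebra_simps)
  also have "\<dots> \<le> ?\<rho> * (C * ?\<rho> ^ k)"
    using a C by (intro mult_right_mono) auto
  finally show ?case by (simp add: mult_ac)
qed (use C in simp)

section \<open>Application to the averaged Hessians and the iteration\<close>

lemma transpose_hess_avg:
  assumes "\<And>i. i \<le> k \<Longrightarrow> twice_continuously_differentiable (sample_avg F (S i))"
  shows "transpose (hess_avg F S \<gamma> w k) = hess_avg F S \<gamma> w k"
proof -
  have "hessian (sample_avg F (S i)) (w i) $ q $ p = hessian (sample_avg F (S i)) (w i) $ p $ q"
    if "i \<le> k" for i p q
    using arg_cong[OF transpose_hessian[OF assms[OF that], of "w i"], of "\<lambda>A. A $ p $ q"]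
    by (simp add: transpose_def)
  then have "hess_avg F S \<gamma> w k $ q $ p = hess_avg F S \<gamma> w k $ p $ q" for p q
    unfolding hess_avg_def sum_component vector_scaleR_component
    by (intro sum.cong) auto
  then show ?thesis
    unfolding vec_eq_iff transpose_def by simp
qed

theorem theorem3p2:
  fixes N :: nat
    and F :: "nat \<Rightarrow> real ^ 'd \<Rightarrow> real"
    and f :: "real ^ 'd \<Rightarrow> real"
    and S :: "nat \<Rightarrow> nat set"
    and \<gamma> :: "nat \<Rightarrow> nat \<Rightarrow> real"
    and w g :: "nat \<Rightarrow> real ^ 'd"
    and wstar :: "real ^ 'd"
    and Ht :: "nat \<Rightarrow> real ^ 'd ^ 'd"
    and \<iota> :: "nat \<Rightarrow> real"
    and L \<mu> \<mu>t Lt \<theta> a \<alpha> :: real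
  assumes N: "1 \<le> N"
    and F_C2: "\<forall>i\<in>{1..N}. twice_continuously_differentiable (F i)"
    and f: "\<forall>x. f x = (1 / real N) * (\<Sum>i=1..N. F i x)"
    and samples: "\<forall>k. S k \<noteq> {} \<and> S k \<subseteq> {1..N}"
    and weights: "\<forall>k. (\<forall>i\<le>k. \<gamma> k i \<in> {0..1}) \<and> (\<Sum>i\<le>k. \<gamma> k i) = 1"
    and \<mu>t: "0 < \<mu>t"
    and Ht: "\<forall>k. Ht k = hess_mod \<mu>t (hess_avg F S \<gamma> w k)"
    and upper: "spectral_upper_bound N F L"
    and Lt: "\<forall>k. Ht k \<preceq> mat Lt" "Lt \<le> L + \<mu>t"
    and \<mu>: "0 < \<mu>"
    and strongly_convex: "\<forall>x. mat \<mu> \<preceq> hessian f x"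
    and wstar: "is_arg_min f (\<lambda>_. True) wstar"
    and step: "\<forall>k. w (Suc k) = w k - \<alpha> *\<^sub>R (matrix_inv (Ht k) *v g k)"
    and norm_condition: "\<forall>k. (mat_norm (matrix_inv (Ht k)) (g k - gradient f (w k)))\<^sup>2
           \<le> \<theta>\<^sup>2 * (mat_norm (matrix_inv (Ht k)) (gradient f (w k)))\<^sup>2 + \<iota> k"
    and \<theta>: "0 \<le> \<theta>" "\<theta> < 1"
    and \<iota>: "0 < \<iota> 0" "\<forall>k. \<iota> (Suc k) = \<iota> k * a"
    and a: "0 \<le> a" "a < 1"
    and \<alpha>: "0 < \<alpha>" "\<alpha> \<le> \<mu>t / L"
  shows "\<forall>k. f (w k) - f wstar
           \<le> max (f (w 0) - f wstar) (Lt * \<iota> 0 / (\<mu> * (1 - \<theta>\<^sup>2)))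
             * (max (1 - \<alpha> * \<mu> * (1 - \<theta>\<^sup>2) / (2 * Lt)) a) ^ k"
proof -
  have f_avg: "f = sample_avg F {1..N}"
    using f by (auto simp: sample_avg_def)
  have C2: "twice_continuously_differentiable f"
    unfolding f_avg using F_C2 by (intro twice_continuously_differentiable_sample_avg) auto
  \<comment> \<open>The objective is the average over the full sample, so the constant for sample
    size \<open>N\<close> applies to it.\<close>
  obtain l where l: "0 < l" "l \<le> L" "\<And>x. hessian f x \<preceq> mat l"
    using upper N unfolding spectral_upper_bound_def f_avg
    by (metis atLeastAtMost_iff card_atLeastAtMost diff_Suc_1 order_refl)
  have L: "hessian f x \<preceq> mat L" for x
    unfolding loewner_le_mat_right
    using l(2) l(3)[of x, unfolded loewner_le_mat_right] by (meson inner_ge_zero mult_right_mono order_trans)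
  have sym: "transpose (Ht k) = Ht k" and low: "mat \<mu>t \<preceq> Ht k" for k
  proof -
    have "transpose (hess_avg F S \<gamma> w k) = hess_avg F S \<gamma> w k"
      using F_C2 samples
      by (intro transpose_hess_avg twice_continuously_differentiable_sample_avg) blast
    then show "transpose (Ht k) = Ht k" "mat \<mu>t \<preceq> Ht k"
      using Ht by (simp_all add: transpose_hess_mod mat_loewner_le_hess_mod)
  qed
  have \<mu>L: "\<mu> \<le> L" and \<mu>tLt: "\<mu>t \<le> Lt"
    using mat_loewner_le_mat strongly_convex L low Lt(1) by blast+
  have pos: "0 < L" "0 < Lt" using l \<mu>t \<mu>tLt by auto
  have \<alpha>L: "\<alpha> * L \<le> \<mu>t" using \<alpha>(2) pos by (simp add: field_simps)
  have \<theta>2: "0 \<le> \<theta>\<^sup>2" "\<theta>\<^sup>2 < 1" using \<theta> by (auto simp: power_less_one_iff abs_square_less_1)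
  define q where "q = \<alpha> * \<mu> * (1 - \<theta>\<^sup>2) / Lt"
  define C where "C = max (f (w 0) - f wstar) (Lt * \<iota> 0 / (\<mu> * (1 - \<theta>\<^sup>2)))"
  have q0: "0 \<le> q" using \<alpha> \<mu> \<theta>2 pos by (simp add: q_def)
  \<comment> \<open>The chain to \<open>q \<le> 1\<close> is \<alpha> \<mu> (1 - \<theta>^2) \<le>
    \<alpha> L \<le> \<open>\<mu>t\<close> \<le> \<open>Lt\<close>.\<close>
  have "\<alpha> * \<mu> * (1 - \<theta>\<^sup>2) \<le> \<alpha> * L * 1"
    using \<alpha> \<mu> \<mu>L \<theta>2 by (intro mult_mono) auto
  then have q1: "q \<le> 1"
    using \<alpha>L \<mu>tLt pos by (simp add: q_def)
  \<comment> \<open>Positivity of the second entry of the maximum makes \<open>C\<close>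
    nonnegative.\<close>
  have bound: "0 < Lt * \<iota> 0 / (\<mu> * (1 - \<theta>\<^sup>2))"
    using pos \<iota> \<mu> \<theta>2 by simp
  have rec: "f (w (Suc k)) - f wstar \<le> (1 - q) * (f (w k) - f wstar) + \<alpha> / 2 * \<iota> k" for k
    unfolding q_def step[rule_format, of k]
    by (rule preconditioned_step_contraction[where L = L and c = \<mu>t])
       (use C2 L \<mu> strongly_convex sym \<mu>t low pos Lt \<alpha> \<alpha>L \<theta>2 norm_condition in auto)
  \<comment> \<open>Naming the positive factor keeps it atomic, so that it cancels in the next
    computation.\<close>
  obtain u where u: "u = 1 - \<theta>\<^sup>2" "0 < u" using \<theta>2 by simp
  \<comment> \<open>The second entry of the maximum is exactly the value for which half of the
    contraction balances the initial perturbation.\<close>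
  have "\<alpha> / 2 * \<iota> 0 = q / 2 * (Lt * \<iota> 0 / (\<mu> * (1 - \<theta>\<^sup>2)))"
    using pos \<mu> u(2) by (simp add: q_def flip: u(1))
  also have "\<dots> \<le> q / 2 * C"
    using q0 by (intro mult_left_mono) (auto simp: C_def)
  finally have r: "\<alpha> / 2 * \<iota> 0 \<le> q / 2 * C" .
  have "f (w k) - f wstar \<le> C * max (1 - q / 2) a ^ k" for k
    by (rule perturbed_linear_convergence[where \<epsilon> = \<iota> and r = "\<alpha> / 2" and \<phi> = "\<lambda>k. f (w k) - f wstar"])
       (use rec \<iota> q1 a(1) r \<alpha>(1) bound in \<open>auto simp: C_def\<close>)
  moreover have "q / 2 = \<alpha> * \<mu> * (1 - \<theta>\<^sup>2) / (2 * Lt)"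
    by (simp add: q_def)
  ultimately show ?thesis
    unfolding C_def by simp
qed

end
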